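(* Let $H$ be a real Hilbert space, let $K\subset H$ be a non-empty closed convex set and let $F\colon K\to H$ be strongly pseudomonotone on $K$ with modulus $\gamma>0$. Suppose that the variational inequality $\mathrm{VI}(K,F)$ admits a unique solution $x^\ast$. Then for all $x\in H$, $$\|x^\ast-\mathrm{Pr}_K(x)\|\le \frac{1}{\gamma}\,\|F_K^{\mathrm{nor}}(x)\|.$$
   Context: $H$ carries the inner product $\langle\cdot,\cdot\rangle$ and the induced norm $\|\cdot\|$. $\mathrm{VI}(K,F)$ is the problem of finding $x^\ast\in K$ such that $\langle F(x^\ast),x-x^\ast\rangle\ge 0$ for all $x\in K$; such an $x^\ast$ is called a solution. $F$ is strongly pseudomonotone on $K$ with modulus $\gamma>0$ if for all $x,y\in K$: $\langle F(y),x-y\rangle\ge 0$ implies $\langle F(x),x-y\rangle\ge\gamma\|x-y\|^2$. $\mathrm{Pr}_K(x)$ denotes the metric projection of $x\in H$ onto $K$, i.e. the unique point of $K$ with $\|x-\mathrm{Pr}_K(x)\|\le\|x-y\|$ for all $y\in K$. The normal map $F_K^{\mathrm{nor}}\colon H\to H$ is defined by $F_K^{\mathrm{nor}}(x):=F(\mathrm{Pr}_K(x))+x-\mathrm{Pr}_K(x)$. No continuity of $F$ is assumed. *)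

theory Defs
  imports "HOL-Analysis.Analysis"
begin

text \<open>
  A real Hilbert space is a type of sort \<open>{real_inner, complete_space}\<close>.  An operator
  \<open>F : K \<rightarrow> H\<close> is a function on the whole type; every definition below evaluates \<open>F\<close>
  only at points of \<open>K\<close>, provided the projection onto \<open>K\<close> exists.
\<close>

definition VI_solution :: "'a::real_inner set \<Rightarrow> ('a \<Rightarrow> 'a) \<Rightarrow> 'a \<Rightarrow> bool" where
  "VI_solution K F z \<longleftrightarrow> z \<in> K \<and> (\<forall>x\<in>K. inner (F z) (x - z) \<ge> 0)"

definition strongly_pseudomonotone_on :: "'a::real_inner set \<Rightarrow> ('a \<Rightarrow> 'a) \<Rightarrow> real \<Rightarrow> bool" where
  "strongly_pseudomonotone_on K F \<gamma> \<longleftrightarrow>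
     (\<forall>x\<in>K. \<forall>y\<in>K. inner (F y) (x - y) \<ge> 0 \<longrightarrow> inner (F x) (x - y) \<ge> \<gamma> * (norm (x - y))\<^sup>2)"

text \<open>
  The library's \<^const>\<open>closest_point\<close> requires class \<open>heine_borel\<close>, which would force the space to
  be finite-dimensional.
\<close>

definition metric_projection :: "'a::real_inner set \<Rightarrow> 'a \<Rightarrow> 'a" where
  "metric_projection K x = (THE p. p \<in> K \<and> (\<forall>y\<in>K. norm (x - p) \<le> norm (x - y)))"

definition normal_map :: "'a::real_inner set \<Rightarrow> ('a \<Rightarrow> 'a) \<Rightarrow> 'a \<Rightarrow> 'a" where
  "normal_map K F x = F (metric_projection K x) + x - metric_projection K x"

end

theory Submission
  imports Defs
begin

text \<open>
  The variational inequality of the projection \<open>p\<close> of \<open>x\<close> gives \<open>\<langle>x - p, p - x*\<rangle> \<ge> 0\<close>, and strong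
  pseudomonotonicity gives \<open>\<langle>F p, p - x*\<rangle> \<ge> \<gamma> \<parallel>p - x*\<parallel>\<^sup>2\<close>.  Adding the two and applying the
  Cauchy--Schwarz inequality bounds \<open>\<gamma> \<parallel>p - x*\<parallel>\<close> by the norm of the normal map at \<open>x\<close>.
  The projection exists because, by the parallelogram law, minimizing sequences in a convex set
  are Cauchy.
\<close>

text \<open>Parallelogram law for \<open>x - y\<close> and \<open>x - z\<close>: the midpoint of
  \<open>y\<close> and \<open>z\<close> stays in \<open>K\<close> by convexity, so its squared
  distance to \<open>x\<close> is at least \<open>s\<close>. With \<open>s\<close> the infimum,
  near-minimizers are close together and minimizers coincide.\<close>

lemma convex_dist_parallelogram_le:
  fixes K :: "'a::real_inner set"
  assumes "convex K" "y \<in> K" "z \<in> K"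
    and lower: "\<forall>w\<in>K. s \<le> (norm (x - w))\<^sup>2"
  shows "(norm (y - z))\<^sup>2 \<le> 2 * (norm (x - y))\<^sup>2 + 2 * (norm (x - z))\<^sup>2 - 4 * s"
proof -
  define m where "m = (1/2) *\<^sub>R y + (1/2) *\<^sub>R z"
  have "m \<in> K"
    unfolding m_def using assms(1-3) by (intro convexD) auto
  then have "s \<le> (norm (x - m))\<^sup>2"
    using lower by blast
  moreover have "(norm (y - z))\<^sup>2
      = 2 * (norm (x - y))\<^sup>2 + 2 * (norm (x - z))\<^sup>2 - 4 * (norm (x - m))\<^sup>2"
    unfolding power2_norm_eq_inner m_def by (simp add: algebra_simps inner_commute)
  ultimately show ?thesis
    by linarith
qed

lemma metric_projection_exists_unique:
  fixes K :: "'a::{real_inner, complete_space} set"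
  assumes "K \<noteq> {}" "closed K" "convex K"
  shows "\<exists>!p. p \<in> K \<and> (\<forall>y\<in>K. norm (x - p) \<le> norm (x - y))"
proof -
  define s where "s = (INF y\<in>K. (norm (x - y))\<^sup>2)"
  have bdd: "bdd_below ((\<lambda>y. (norm (x - y))\<^sup>2) ` K)"
    by (rule bdd_belowI[of _ 0]) auto
  have s_le: "\<forall>y\<in>K. s \<le> (norm (x - y))\<^sup>2"
    unfolding s_def using bdd by (auto intro: cINF_lower)
  have "\<exists>y\<in>K. (norm (x - y))\<^sup>2 < s + inverse (real (Suc n))" for n
    using cINF_less_iff[OF assms(1) bdd, of "s + inverse (real (Suc n))"]
    by (simp add: s_def)
  then obtain f where fK: "\<And>n. f n \<in> K"
    and f_less: "\<And>n. (norm (x - f n))\<^sup>2 < s + inverse (real (Suc n))"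
    by metis
  have "Cauchy f"
  proof (rule metric_CauchyI)
    fix e :: real
    assume "e > 0"
    \<comment> \<open>The parallelogram bound doubles each of two excesses over \<open>s\<close>;
      excesses below \<open>e\<^sup>2 / 4\<close> thus give a total below
      \<open>e\<^sup>2\<close>.\<close>
    then obtain N where N: "inverse (real (Suc N)) < e\<^sup>2 / 4"
      using reals_Archimedean[of "e\<^sup>2 / 4"] by auto
    have small: "(norm (x - f n))\<^sup>2 - s < e\<^sup>2 / 4" if "n \<ge> N" for n
    proof -
      have "inverse (real (Suc n)) \<le> inverse (real (Suc N))"
        using that by (intro le_imp_inverse_le) auto
      then show ?thesis
        using f_less[of n] N by linarith
    qed
    have "dist (f m) (f n) < e" if "m \<ge> N" "n \<ge> N" for m n
    proof -
      have "(norm (f m - f n))\<^sup>2 < e\<^sup>2"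
        using convex_dist_parallelogram_le[OF assms(3) fK fK s_le, of m n] small[OF that(1)] small[OF that(2)]
        by linarith
      then show ?thesis
        using \<open>e > 0\<close> by (simp add: dist_norm power_less_imp_less_base)
    qed
    then show "\<exists>M. \<forall>m\<ge>M. \<forall>n\<ge>M. dist (f m) (f n) < e"
      by blast
  qed
  then obtain p where lim: "f \<longlonglongrightarrow> p"
    using Cauchy_convergent convergent_def by blast
  have pK: "p \<in> K"
    using closed_sequentially[OF assms(2)] fK lim by blast
  have "(\<lambda>n. (norm (x - f n))\<^sup>2) \<longlonglongrightarrow> (norm (x - p))\<^sup>2"
    by (intro tendsto_intros lim)
  moreover have "(\<lambda>n. s + inverse (real (Suc n))) \<longlonglongrightarrow> s"
    using tendsto_add[OF tendsto_const LIMSEQ_inverse_real_of_nat, of s] by simp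
  ultimately have p_le: "(norm (x - p))\<^sup>2 \<le> s"
    by (rule LIMSEQ_le) (use f_less in \<open>auto intro: less_imp_le\<close>)
  show ?thesis
  proof (rule ex1I[of _ p])
    show "p \<in> K \<and> (\<forall>y\<in>K. norm (x - p) \<le> norm (x - y))"
      using pK p_le s_le by (meson norm_ge_zero order_trans power2_le_imp_le)
  next
    fix q
    assume q: "q \<in> K \<and> (\<forall>y\<in>K. norm (x - q) \<le> norm (x - y))"
    \<comment> \<open>Comparing \<open>q\<close> with \<open>p\<close> shows that \<open>q\<close>
      attains \<open>s\<close> too, so the parallelogram bound becomes
      \<open>2 * s + 2 * s - 4 * s = 0\<close>.\<close>
    then have "(norm (x - q))\<^sup>2 \<le> s"
      using pK p_le by (meson norm_ge_zero order_trans power_mono)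
    then have "(norm (q - p))\<^sup>2 \<le> 0"
      using convex_dist_parallelogram_le[OF assms(3) conjunct1[OF q] pK s_le] p_le by linarith
    then show "q = p"
      by simp
  qed
qed

lemma
  fixes K :: "'a::{real_inner, complete_space} set"
  assumes "K \<noteq> {}" "closed K" "convex K"
  shows metric_projection_in: "metric_projection K x \<in> K"
    and metric_projection_le: "y \<in> K \<Longrightarrow> norm (x - metric_projection K x) \<le> norm (x - y)"
  using theI'[OF metric_projection_exists_unique[OF assms, of x]]
  unfolding metric_projection_def by blast+

text \<open>If the angle at the projection were acute, a small move towards \<open>y\<close> would
  stay in \<open>K\<close> by convexity and come strictly closer to \<open>x\<close>.\<close>

lemma metric_projection_inner_le:
  fixes K :: "'a::{real_inner, complete_space} set"
  assumes "K \<noteq> {}" "closed K" "convex K" "y \<in> K"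
  shows "inner (x - metric_projection K x) (y - metric_projection K x) \<le> 0"
proof (rule ccontr)
  let ?p = "metric_projection K x"
  assume "\<not> ?thesis"
  then obtain u where u: "0 < u" "u \<le> 1" "dist (?p + u *\<^sub>R (y - ?p)) x < dist ?p x"
    using closer_point_lemma[of x ?p y] by (auto simp: dist_commute inner_commute)
  have "?p + u *\<^sub>R (y - ?p) = (1 - u) *\<^sub>R ?p + u *\<^sub>R y"
    by (simp add: algebra_simps)
  also have "\<dots> \<in> K"
    using assms u metric_projection_in[OF assms(1-3)] by (intro convexD) auto
  finally show False
    using u(3) metric_projection_le[OF assms(1-3), of _ x] by (force simp: dist_norm norm_minus_commute)
qed

theorem theorem3p2:
  fixes K :: "'a::{real_inner, complete_space} set"
    and F :: "'a \<Rightarrow> 'a"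
    and \<gamma> :: real
    and xstar :: 'a
  assumes "K \<noteq> {}" and "closed K" and "convex K"
    and "\<gamma> > 0"
    and "strongly_pseudomonotone_on K F \<gamma>"
    and "\<exists>!z. VI_solution K F z"
    and "VI_solution K F xstar"
  shows "\<forall>x. norm (xstar - metric_projection K x) \<le> (1 / \<gamma>) * norm (normal_map K F x)"
proof
  fix x
  define p where "p = metric_projection K x"
  have pK: "p \<in> K"
    unfolding p_def using assms(1-3) by (rule metric_projection_in)
  have sol: "xstar \<in> K" "inner (F xstar) (p - xstar) \<ge> 0"
    using assms(7) pK by (auto simp: VI_solution_def)
  have "inner (x - p) (xstar - p) \<le> 0"
    unfolding p_def using assms(1-3) sol(1) by (rule metric_projection_inner_le)
  \<comment> \<open>Pseudomonotonicity is used at the pair \<open>p\<close>, \<open>xstar\<close>;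
    its premise is the variational inequality for \<open>xstar\<close> tested with
    \<open>p\<close>.\<close>
  moreover have "\<gamma> * (norm (p - xstar))\<^sup>2 \<le> inner (F p) (p - xstar)"
    using assms(5) pK sol by (auto simp: strongly_pseudomonotone_on_def)
  \<comment> \<open>The normal map at \<open>x\<close> is \<open>F p + (x - p)\<close>, and
    \<open>inner (x - p) (p - xstar)\<close> is nonnegative by the projection inequality.\<close>
  ultimately have "\<gamma> * (norm (p - xstar))\<^sup>2 \<le> inner (normal_map K F x) (p - xstar)"
    by (simp add: normal_map_def flip: p_def) (simp add: inner_simps)
  also have "\<dots> \<le> norm (normal_map K F x) * norm (p - xstar)"
    by (rule norm_cauchy_schwarz)
  finally have "\<gamma> * norm (p - xstar) \<le> norm (normal_map K F x)"
    \<comment> \<open>One factor \<open>norm (p - xstar)\<close> cancels when it is nonzero;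
      otherwise the left side is 0.\<close>
    by (cases "p = xstar") (auto simp: power2_eq_square)
  then show "norm (xstar - metric_projection K x) \<le> (1 / \<gamma>) * norm (normal_map K F x)"
    using assms(4) by (simp add: field_simps norm_minus_commute flip: p_def)
qed

end
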